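(* Let $\alpha\in(0,1)$ and let $X$ and $Y$ be (integrable, real-valued) random variables with probability density functions $f_x$ and $f_y$ respectively. Let $h:\mathbb{R}\to[0,\infty)$ be continuous and set $g(z)=\int_{-\infty}^z h(x)\,dx$. If $\lim_{z\to-\infty}g(z)=0$ and $f_x(x)\le f_y(x)+h(x)$ for all $x\in\mathbb{R}$, then $F_{Y^L}(y)=\min(1,F_Y(y)+g(y))$ is a cumulative distribution function, and a random variable $Y^L$ with CDF $F_{Y^L}$ satisfies $$\mathrm{CVaR}_\alpha(Y^L)\le\mathrm{CVaR}_\alpha(X).$$
   Context: $X$ and $Y$ are real-valued with finite first absolute moment. $F_Y(y)=P(Y\le y)$. For $\alpha\in(0,1)$, $\mathrm{CVaR}_\alpha(X)=\inf_{w\in\mathbb{R}}\{w+\frac1\alpha\mathbb{E}[(X-w)^+]\}$, with $(x)^+=\max(x,0)$; the same formula defines $\mathrm{CVaR}_\alpha(Y^L)$. *)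

theory Defs
  imports "HOL-Probability.Probability"
begin

text \<open>The expectation of the nonnegative variable \<open>(X - w)\<^sup>+\<close> is taken in \<open>[0, \<infinity>]\<close> and the
  infimum over \<open>w\<close> in the extended reals, so that the formula is meaningful for every
  real random variable, integrable or not.\<close>

definition CVaR :: "real \<Rightarrow> 'a measure \<Rightarrow> ('a \<Rightarrow> real) \<Rightarrow> ereal" where
  "CVaR \<alpha> M X =
     (INF w::real. ereal w + ereal (1 / \<alpha>) * enn2ereal (\<integral>\<^sup>+ \<omega>. ennreal (max (X \<omega> - w) 0) \<partial>M))"

text \<open>The integral of a nonnegative \<open>h\<close> over \<open>(-\<infinity>, z]\<close> as an extended nonnegative real: it is
  \<open>\<infinity>\<close>, not a default value, when \<open>h\<close> is not integrable there. In particular, if it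
  tends to 0 at \<open>-\<infinity>\<close> and \<open>h\<close> is continuous, it is finite for every \<open>z\<close>.\<close>

definition left_integral :: "(real \<Rightarrow> real) \<Rightarrow> real \<Rightarrow> ennreal" where
  "left_integral h z = (\<integral>\<^sup>+ x \<in> {..z}. ennreal (h x) \<partial>lborel)"

text \<open>The function \<open>min (1, F + g)\<close>; the minimum is at most 1, so \<^const>\<open>enn2real\<close> loses nothing.\<close>

definition capped_cdf :: "(real \<Rightarrow> real) \<Rightarrow> (real \<Rightarrow> ennreal) \<Rightarrow> real \<Rightarrow> real" where
  "capped_cdf F g y = enn2real (min 1 (ennreal (F y) + g y))"

end

theory Submission
  imports Defs
begin

text \<open>Integrating the density inequality over \<open>(-\<infinity>, y]\<close> gives \<open>F\<^sub>X \<le> min 1 (F\<^sub>Y + g)\<close>, so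
  \<open>Y\<^sup>L\<close> is stochastically dominated by \<open>X\<close>. Since \<open>E[(X - w)\<^sup>+]\<close> is the integral of the survival
  function of \<open>X\<close> over \<open>[w, \<infinity>)\<close>, the CVaR respects this order, already for each fixed \<open>w\<close>.\<close>

text \<open>Layer-cake formula: \<open>max (x - w) 0\<close> is the Lebesgue measure of
  \<open>{w..<x}\<close>, and Tonelli's theorem exchanges the integral over \<open>t\<close> with
  the expectation.\<close>

lemma (in prob_space) nn_integral_excess_eq:
  fixes X :: "'a \<Rightarrow> real"
  assumes [measurable]: "X \<in> borel_measurable M"
  shows "(\<integral>\<^sup>+ \<omega>. ennreal (max (X \<omega> - w) 0) \<partial>M) =
         (\<integral>\<^sup>+ t \<in> {w..}. ennreal (1 - cdf (distr M borel X) t) \<partial>lborel)"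
proof -
  interpret L: pair_sigma_finite M lborel ..
  interpret D: real_distribution "distr M borel X"
    by simp
  let ?f = "\<lambda>t \<omega>. indicator {w..} t * indicator {t<..} (X \<omega>) :: ennreal"
  have pt: "ennreal (max (x - w) 0) = (\<integral>\<^sup>+ t. indicator {w..} t * indicator {t<..} x \<partial>lborel)" for x
  proof -
    have "(\<integral>\<^sup>+ t. indicator {w..} t * indicator {t<..} x \<partial>lborel) =
          (\<integral>\<^sup>+ t. indicator {w..<x} t \<partial>lborel)"
      by (intro nn_integral_cong) (auto split: split_indicator)
    also have "\<dots> = ennreal (max (x - w) 0)"
      by (cases "w \<le> x") (auto simp: max_def)
    finally show ?thesis ..
  qed
  have surv: "(\<integral>\<^sup>+ \<omega>. indicator {t<..} (X \<omega>) \<partial>M) = ennreal (1 - cdf (distr M borel X) t)" for t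
  proof -
    have "(\<integral>\<^sup>+ \<omega>. indicator {t<..} (X \<omega>) \<partial>M) = emeasure (distr M borel X) (UNIV - {..t})"
      using nn_integral_distr[of X M borel "indicator {t<..}"] by (simp add: Compl_eq_Diff_UNIV[symmetric])
    also have "\<dots> = ennreal (1 - cdf (distr M borel X) t)"
      using D.prob_compl[of "{..t}"] by (simp add: D.emeasure_eq_measure cdf_def)
    finally show ?thesis .
  qed
  have "(\<integral>\<^sup>+ \<omega>. ennreal (max (X \<omega> - w) 0) \<partial>M) = (\<integral>\<^sup>+ \<omega>. (\<integral>\<^sup>+ t. ?f t \<omega> \<partial>lborel) \<partial>M)"
    by (simp only: pt)
  also have "\<dots> = (\<integral>\<^sup>+ t. (\<integral>\<^sup>+ \<omega>. ?f t \<omega> \<partial>M) \<partial>lborel)"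
    \<comment> \<open>The set \<open>{t<..}\<close> varies with \<open>t\<close>; joint
      measurability becomes visible once the indicators are unfolded to conditions such as
      \<open>t < X \<omega>\<close>.\<close>
    by (rule L.Fubini'[symmetric]) (unfold indicator_def atLeast_iff greaterThan_iff, measurable)
  also have "\<dots> = (\<integral>\<^sup>+ t \<in> {w..}. ennreal (1 - cdf (distr M borel X) t) \<partial>lborel)"
    by (simp add: nn_integral_cmult surv mult.commute)
  finally show ?thesis .
qed

lemma CVaR_antimono_cdf:
  assumes "prob_space M" "X \<in> borel_measurable M" "prob_space K" "Z \<in> borel_measurable K"
    and "0 \<le> \<alpha>" and le: "\<And>t. cdf (distr M borel X) t \<le> cdf (distr K borel Z) t"
  shows "CVaR \<alpha> K Z \<le> CVaR \<alpha> M X"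
proof -
  have "(\<integral>\<^sup>+ \<omega>. ennreal (max (Z \<omega> - w) 0) \<partial>K) \<le> (\<integral>\<^sup>+ \<omega>. ennreal (max (X \<omega> - w) 0) \<partial>M)" for w
    using assms unfolding prob_space.nn_integral_excess_eq[OF assms(1,2)]
      prob_space.nn_integral_excess_eq[OF assms(3,4)]
    by (intro nn_integral_mono mult_right_mono ennreal_leI) (auto simp: le)
  \<comment> \<open>The infima are compared term by term. The factor \<open>1 / \<alpha>\<close> is
    nonnegative even at \<open>\<alpha> = 0\<close>, where it is 0 by convention.\<close>
  then show ?thesis
    unfolding CVaR_def using \<open>0 \<le> \<alpha>\<close>
    by (intro INF_mono' add_left_mono ereal_mult_left_mono) (auto simp: less_eq_ennreal.rep_eq)
qed

text \<open>Reading the integral as the mass of a half-line under the measure with density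
  \<open>h\<close> gives access to continuity from above.\<close>

lemma left_integral_eq_emeasure:
  assumes "h \<in> borel_measurable borel"
  shows "left_integral h z = emeasure (density lborel (\<lambda>x. ennreal (h x))) {..z}"
  using assms by (simp add: left_integral_def emeasure_density)

lemma left_integral_mono: "y \<le> z \<Longrightarrow> left_integral h y \<le> left_integral h z"
  unfolding left_integral_def by (intro nn_integral_mono) (auto split: split_indicator)

text \<open>The limit makes the integral smaller than 1 up to some \<open>a\<close>; from
  \<open>a\<close> to \<open>z\<close> a continuous function is integrated over a compact
  interval.\<close>

lemma left_integral_finite:
  fixes h :: "real \<Rightarrow> real"
  assumes cont: "continuous_on UNIV h" and nn: "\<And>x. 0 \<le> h x"
    and lim: "(left_integral h \<longlongrightarrow> 0) at_bot"
  shows "left_integral h z < \<infinity>"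
proof -
  have [measurable]: "h \<in> borel_measurable borel"
    using cont by (rule borel_measurable_continuous_onI)
  have "\<forall>\<^sub>F x in at_bot. left_integral h x < 1"
    using order_tendstoD(2)[OF lim, of 1] by simp
  then obtain a where a: "left_integral h a < 1"
    by (auto simp: eventually_at_bot_linorder)
  have "set_integrable lborel {a..z} h"
    using cont by (intro borel_integrable_atLeastAtMost') (rule continuous_on_subset, auto)
  then have "(\<integral>\<^sup>+ x \<in> {a..z}. ennreal (h x) \<partial>lborel) < \<infinity>"
    using nn by (simp add: set_integrable_def integrable_iff_bounded ennreal_mult''
        abs_mult ennreal_indicator mult.commute)
  \<comment> \<open>Only the covering of \<open>{..z}\<close> by \<open>{..a}\<close> and
    \<open>{a..z}\<close> is used, so the case \<open>z < a\<close> needs no separate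
    treatment.\<close>
  moreover have "left_integral h z \<le> left_integral h a + (\<integral>\<^sup>+ x \<in> {a..z}. ennreal (h x) \<partial>lborel)"
    unfolding left_integral_def
    by (subst nn_integral_add[symmetric]) (auto intro!: nn_integral_mono split: split_indicator)
  ultimately show ?thesis
    using a by (auto intro: le_less_trans simp: less_top[symmetric] ennreal_add_eq_top top_unique)
qed

text \<open>Continuity from above along decreasing half-lines; finiteness is what permits it. The
  bound \<open>a + 1\<close> is an arbitrary point to the right of \<open>a\<close>.\<close>

lemma left_integral_right_continuous:
  assumes h: "h \<in> borel_measurable borel" and fin: "\<And>z. left_integral h z < \<infinity>"
  shows "(left_integral h \<longlongrightarrow> left_integral h a) (at_right a)"
proof (rule tendsto_at_right_sequentially[where b = "a + 1"])
  fix f :: "nat \<Rightarrow> real"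
  assume f: "decseq f" "f \<longlonglongrightarrow> a"
  have "(\<lambda>n. left_integral h (f n)) \<longlonglongrightarrow> emeasure (density lborel (\<lambda>x. ennreal (h x))) (\<Inter>i. {..f i})"
    unfolding left_integral_eq_emeasure[OF h]
    using f(1) fin by (intro Lim_emeasure_decseq)
      (auto simp: decseq_def left_integral_eq_emeasure[OF h, symmetric] less_top)
  also have "(\<Inter>i. {..f i}) = {..a}"
    using decseq_ge[OF f] by (auto intro: order_trans LIMSEQ_le_const[OF f(2)])
  finally show "(\<lambda>n. left_integral h (f n)) \<longlonglongrightarrow> left_integral h a"
    by (simp only: left_integral_eq_emeasure[OF h])
qed simp

text \<open>The cap keeps the value finite even where \<open>g y\<close> is infinite, so
  inequalities can be proved in \<open>ennreal\<close> and transferred back to the reals.\<close>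

lemma ennreal_capped_cdf: "ennreal (capped_cdf F g y) = min 1 (ennreal (F y) + g y)"
  unfolding capped_cdf_def by (rule ennreal_enn2real) (simp add: min_less_iff_disj)

lemma capped_cdf_tendsto:
  assumes "(F \<longlongrightarrow> l) A" "(g \<longlongrightarrow> m) A"
  shows "(capped_cdf F g \<longlongrightarrow> enn2real (min 1 (ennreal l + m))) A"
  unfolding capped_cdf_def
proof (rule tendsto_enn2real)
  show "((\<lambda>y. min 1 (ennreal (F y) + g y)) \<longlongrightarrow> ennreal (enn2real (min 1 (ennreal l + m)))) A"
    using assms by (subst ennreal_enn2real) (auto simp: min_less_iff_disj intro!: tendsto_intros)
qed simp

text \<open>The witness is the Lebesgue-Stieltjes measure of the capped function, which inherits
  monotonicity, right continuity and the limit at \<open>-\<infinity>\<close> from both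
  summands.\<close>

lemma real_distribution_capped_cdf:
  assumes "real_distribution \<nu>" and mono: "\<And>y z. y \<le> z \<Longrightarrow> g y \<le> g z"
    and right_cont: "\<And>a. (g \<longlongrightarrow> g a) (at_right a)" and bot: "(g \<longlongrightarrow> 0) at_bot"
  shows "\<exists>\<mu>. real_distribution \<mu> \<and> cdf \<mu> = capped_cdf (cdf \<nu>) g"
proof -
  interpret real_distribution \<nu> by fact
  let ?C = "capped_cdf (cdf \<nu>) g"
  have C_mono: "?C y \<le> ?C z" if "y \<le> z" for y z
    unfolding capped_cdf_def using that cdf_nondecreasing mono
    by (intro enn2real_mono min.mono add_mono ennreal_leI) (auto simp: min_less_iff_disj)
  have C_right: "continuous (at_right a) ?C" for a
    using capped_cdf_tendsto[OF cdf_is_right_cont[unfolded continuous_within] right_cont]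
    by (simp add: continuous_within capped_cdf_def)
  have C_bot: "(?C \<longlongrightarrow> 0) at_bot"
    using capped_cdf_tendsto[OF cdf_lim_at_bot bot] by simp
  have "cdf \<nu> y \<le> ?C y" "?C y \<le> 1" for y
  proof -
    have "ennreal (cdf \<nu> y) \<le> ennreal (?C y)" "ennreal (?C y) \<le> ennreal 1"
      using cdf_bounded_prob[of y] by (auto simp: ennreal_capped_cdf intro: ennreal_leI)
    then show "cdf \<nu> y \<le> ?C y" "?C y \<le> 1"
      by (auto simp: capped_cdf_def)
  qed
  \<comment> \<open>Nothing is known about \<open>g\<close> at \<open>\<infinity>\<close>; the limit
    comes from squeezing between \<open>cdf \<nu>\<close> and the cap 1.\<close>
  then have C_top: "(?C \<longlongrightarrow> 1) at_top"
    by (intro tendsto_sandwich[OF _ _ cdf_lim_at_top_prob tendsto_const]) auto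
  show ?thesis
    using real_distribution_interval_measure[OF C_mono C_right C_bot C_top]
      cdf_interval_measure[OF C_mono C_right C_bot] by blast
qed

lemma ennreal_cdf_distributed:
  assumes "prob_space M" and X: "distributed M lborel X f"
  shows "ennreal (cdf (distr M borel X) y) = (\<integral>\<^sup>+ x \<in> {..y}. f x \<partial>lborel)"
proof -
  interpret prob_space M by fact
  have [measurable]: "X \<in> borel_measurable M"
    using distributed_measurable[OF X] by simp
  interpret D: real_distribution "distr M borel X"
    by simp
  have "ennreal (cdf (distr M borel X) y) = emeasure M (X -` {..y} \<inter> space M)"
    by (simp add: cdf_def D.emeasure_eq_measure[symmetric] emeasure_distr)
  then show ?thesis
    using distributed_emeasure[OF X, of "{..y}"] by simp
qed

lemma cdf_le_capped_cdf:
  assumes M: "prob_space M" "distributed M lborel X (\<lambda>x. ennreal (f\<^sub>x x))"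
    and N: "prob_space N" "distributed N lborel Y (\<lambda>x. ennreal (f\<^sub>y x))"
    and f\<^sub>y: "\<And>x. 0 \<le> f\<^sub>y x" and h: "h \<in> borel_measurable borel" "\<And>x. 0 \<le> h x"
    and le: "\<And>x. f\<^sub>x x \<le> f\<^sub>y x + h x"
  shows "cdf (distr M borel X) y \<le> capped_cdf (cdf (distr N borel Y)) (left_integral h) y"
proof -
  interpret prob_space M by fact
  have "X \<in> borel_measurable M"
    using distributed_measurable[OF M(2)] by simp
  then interpret D: real_distribution "distr M borel X"
    by simp
  note [measurable] = h(1) distributed_borel_measurable[OF N(2)]
  \<comment> \<open>Since \<open>ennreal\<close> truncates negative numbers to 0, splitting the sum
    relies on both \<open>f\<^sub>y\<close> and \<open>h\<close> being nonnegative.\<close>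
  have "ennreal (cdf (distr M borel X) y) \<le> (\<integral>\<^sup>+ x \<in> {..y}. (ennreal (f\<^sub>y x) + ennreal (h x)) \<partial>lborel)"
    unfolding ennreal_cdf_distributed[OF M] using le f\<^sub>y h(2)
    by (intro nn_integral_mono mult_right_mono)
      (auto simp: ennreal_plus[symmetric] simp del: ennreal_plus intro: ennreal_leI)
  also have "\<dots> = ennreal (cdf (distr N borel Y) y) + left_integral h y"
    unfolding ennreal_cdf_distributed[OF N] left_integral_def
    by (simp add: distrib_right nn_integral_add)
  \<comment> \<open>The cap preserves the bound because a probability is at most 1.\<close>
  finally have "ennreal (cdf (distr M borel X) y) \<le>
      ennreal (capped_cdf (cdf (distr N borel Y)) (left_integral h) y)"
    using D.cdf_bounded_prob[of y] by (simp add: ennreal_capped_cdf)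
  then show ?thesis
    by (simp add: capped_cdf_def)
qed

theorem theorem5p4:
  fixes \<alpha> :: real
    and M :: "'a measure" and X :: "'a \<Rightarrow> real"
    and N :: "'b measure" and Y :: "'b \<Rightarrow> real"
    and f\<^sub>x f\<^sub>y h :: "real \<Rightarrow> real"
  assumes "0 < \<alpha>" and "\<alpha> < 1"
    and "prob_space M" and "integrable M X"
    and "prob_space N" and "integrable N Y"
    and "\<And>x. 0 \<le> f\<^sub>x x" and "distributed M lborel X (\<lambda>x. ennreal (f\<^sub>x x))"
    and "\<And>x. 0 \<le> f\<^sub>y x" and "distributed N lborel Y (\<lambda>x. ennreal (f\<^sub>y x))"
    and "continuous_on UNIV h" and "\<And>x. 0 \<le> h x"
    and "(left_integral h \<longlongrightarrow> 0) at_bot"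
    and "\<And>x. f\<^sub>x x \<le> f\<^sub>y x + h x"
  shows "(\<exists>\<mu>. real_distribution \<mu> \<and>
            cdf \<mu> = capped_cdf (cdf (distr N borel Y)) (left_integral h)) \<and>
         (\<forall>(K :: 'c measure) (YL :: 'c \<Rightarrow> real).
            prob_space K \<longrightarrow> YL \<in> borel_measurable K \<longrightarrow>
            cdf (distr K borel YL) = capped_cdf (cdf (distr N borel Y)) (left_integral h) \<longrightarrow>
            CVaR \<alpha> K YL \<le> CVaR \<alpha> M X)"
proof (intro conjI allI impI)
  have h: "h \<in> borel_measurable borel"
    using assms(11) by (rule borel_measurable_continuous_onI)
  have Y: "Y \<in> borel_measurable N"
    using assms(6) by (rule borel_measurable_integrable)
  show "\<exists>\<mu>. real_distribution \<mu> \<and> cdf \<mu> = capped_cdf (cdf (distr N borel Y)) (left_integral h)"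
    \<comment> \<open>The limit of \<open>left_integral h\<close> at \<open>-\<infinity>\<close>
      enters twice: as the lower limit of the new cdf, and through finiteness in right
      continuity.\<close>
    using assms(11-13) h
    by (intro real_distribution_capped_cdf prob_space.real_distribution_distr[OF assms(5) Y]
        left_integral_mono left_integral_right_continuous left_integral_finite)
  fix K :: "'c measure" and YL :: "'c \<Rightarrow> real"
  assume K: "prob_space K" "YL \<in> borel_measurable K"
    and cdf: "cdf (distr K borel YL) = capped_cdf (cdf (distr N borel Y)) (left_integral h)"
  show "CVaR \<alpha> K YL \<le> CVaR \<alpha> M X"
  proof (rule CVaR_antimono_cdf[OF assms(3) borel_measurable_integrable[OF assms(4)] K])
    show "cdf (distr M borel X) t \<le> cdf (distr K borel YL) t" for t
      unfolding cdf using assms h by (intro cdf_le_capped_cdf)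
  qed (use assms(1) in simp)
qed

end
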